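(* Let $n\ge 3$, let $k=\lfloor n/2\rfloor$, let $q\in\mathbb{C}\setminus\{0\}$ be not a root of unity, and let $T$ be a finite dimensional irreducible representation of $U'_q({\rm so}_n)$. Then: (a) for each $i=1,\dots,k$, the eigenvalues of the operator $T(I_{2i,2i-1})$ are all of the classical type or all of the nonclassical type; (b) moreover, all operators $T(I_{2i,2i-1})$, $i=1,2,\dots,k$, have eigenvalues of the same type.
   Context: $U'_q({\rm so}_n)$ is the complex unital associative algebra generated by $I_{21},I_{32},\dots,I_{n,n-1}$ with relations $I_{i,i-1}^2I_{i+1,i}-(q+q^{-1})I_{i,i-1}I_{i+1,i}I_{i,i-1}+I_{i+1,i}I_{i,i-1}^2=-I_{i+1,i}$, $I_{i,i-1}I_{i+1,i}^2-(q+q^{-1})I_{i+1,i}I_{i,i-1}I_{i+1,i}+I_{i+1,i}^2I_{i,i-1}=-I_{i,i-1}$, and $I_{i,i-1}I_{j,j-1}=I_{j,j-1}I_{i,i-1}$ for $|i-j|>1$. Representations are on complex vector spaces. Fix a square root $q^{1/2}$; powers $q^{a}$, $a\in\frac12\mathbb{Z}$, are powers of it. Put $[m]_q=\frac{q^m-q^{-m}}{q-q^{-1}}$ and $[m]_+=\frac{q^m+q^{-m}}{q-q^{-1}}$. An eigenvalue is of the classical type if it has the form ${\rm i}[m]_q$ with $m\in\frac12\mathbb{Z}$, and of the nonclassical type if it has the form $\pm[m]_+$ with $m\in\frac12+\mathbb{Z}$. *)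

theory Defs
  imports Complex_Main "HOL-Library.Poly_Mapping" "HOL-Algebra.QuotRing"
begin

section \<open>Free associative algebras\<close>

text \<open>
  Words are wrapped in a datatype of their own, so that the additive notation which
  \<^theory>\<open>HOL-Library.Poly_Mapping\<close> uses for monoids is not imposed on lists.
\<close>

datatype 'a word = Word (letters: "'a list")

instantiation word :: (type) monoid_add
begin

definition zero_word :: "'a word" where
  "0 = Word []"

definition plus_word :: "'a word \<Rightarrow> 'a word \<Rightarrow> 'a word" where
  "u + v = Word (letters u @ letters v)"

instance
  by standard (simp_all add: zero_word_def plus_word_def)

end

type_synonym 'a free = "'a word \<Rightarrow>\<^sub>0 complex"

abbreviation gen :: "'a \<Rightarrow> 'a free" where
  "gen x \<equiv> Poly_Mapping.single (Word [x]) 1"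

abbreviation const :: "complex \<Rightarrow> 'a free" where
  "const c \<equiv> Poly_Mapping.single 0 c"

text \<open>The free complex unital associative algebra on the set \<open>X\<close> of generators.\<close>

definition free_algebra :: "'a set \<Rightarrow> 'a free ring" where
  "free_algebra X =
    \<lparr>carrier = {p. \<forall>w\<in>Poly_Mapping.keys p. set (letters w) \<subseteq> X},
     mult = (*), one = 1, zero = 0, add = (+)\<rparr>"

lemma free_algebra_simps [simp]:
  "p \<in> carrier (free_algebra X) \<longleftrightarrow> (\<forall>w\<in>Poly_Mapping.keys p. set (letters w) \<subseteq> X)"
  "mult (free_algebra X) = (*)" "one (free_algebra X) = 1"
  "zero (free_algebra X) = 0" "add (free_algebra X) = (+)"
  by (simp_all add: free_algebra_def)

lemma free_algebra_closed:
  shows const_closed: "const c \<in> carrier (free_algebra X)"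
    and gen_closed: "x \<in> X \<Longrightarrow> gen x \<in> carrier (free_algebra X)"
    and uminus_closed: "p \<in> carrier (free_algebra X) \<Longrightarrow> - p \<in> carrier (free_algebra X)"
    and add_closed: "p \<in> carrier (free_algebra X) \<Longrightarrow> p' \<in> carrier (free_algebra X)
           \<Longrightarrow> p + p' \<in> carrier (free_algebra X)"
    and diff_closed: "p \<in> carrier (free_algebra X) \<Longrightarrow> p' \<in> carrier (free_algebra X)
           \<Longrightarrow> p - p' \<in> carrier (free_algebra X)"
    and mult_closed: "p \<in> carrier (free_algebra X) \<Longrightarrow> p' \<in> carrier (free_algebra X)
           \<Longrightarrow> p * p' \<in> carrier (free_algebra X)"
proof -
  show "const c \<in> carrier (free_algebra X)"
    by (simp add: zero_word_def)
  show "gen x \<in> carrier (free_algebra X)" if "x \<in> X"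
    using that by simp
  show uminus: "- p \<in> carrier (free_algebra X)" if "p \<in> carrier (free_algebra X)" for p
    using that by simp
  show add: "p + p' \<in> carrier (free_algebra X)"
    if "p \<in> carrier (free_algebra X)" "p' \<in> carrier (free_algebra X)" for p p'
    using that Poly_Mapping.keys_add[of p p'] by auto
  show "p - p' \<in> carrier (free_algebra X)"
    if "p \<in> carrier (free_algebra X)" "p' \<in> carrier (free_algebra X)"
    using add[OF that(1) uminus[OF that(2)]] by (simp only: diff_conv_add_uminus)
  show "p * p' \<in> carrier (free_algebra X)"
    if p: "p \<in> carrier (free_algebra X)" and p': "p' \<in> carrier (free_algebra X)"
    unfolding free_algebra_simps(1)
  proof
    fix w assume "w \<in> Poly_Mapping.keys (p * p')"
    then obtain u v where "w = u + v" "u \<in> Poly_Mapping.keys p" "v \<in> Poly_Mapping.keys p'"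
      using keys_mult[of p p'] by blast
    then show "set (letters w) \<subseteq> X"
      using p p' by (simp add: plus_word_def)
  qed
qed

lemma ring_free_algebra: "ring (free_algebra X)"
proof (rule ringI)
  show "abelian_group (free_algebra X)"
  proof (rule abelian_groupI)
    fix p assume p: "p \<in> carrier (free_algebra X)"
    show "\<exists>p'\<in>carrier (free_algebra X).
        p' \<oplus>\<^bsub>free_algebra X\<^esub> p = \<zero>\<^bsub>free_algebra X\<^esub>"
      by (rule bexI[OF _ uminus_closed[OF p]]) simp
  next
    fix p p' assume "p \<in> carrier (free_algebra X)" "p' \<in> carrier (free_algebra X)"
    then show "p \<oplus>\<^bsub>free_algebra X\<^esub> p' \<in> carrier (free_algebra X)"
      unfolding free_algebra_simps(5) by (rule add_closed)
  qed (simp_all add: add.assoc add.commute)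
  show "monoid (free_algebra X)"
  proof (rule monoidI)
    fix p p' assume "p \<in> carrier (free_algebra X)" "p' \<in> carrier (free_algebra X)"
    then show "p \<otimes>\<^bsub>free_algebra X\<^esub> p' \<in> carrier (free_algebra X)"
      unfolding free_algebra_simps(2) by (rule mult_closed)
  next
    show "\<one>\<^bsub>free_algebra X\<^esub> \<in> carrier (free_algebra X)"
      using const_closed[of 1 X] by simp
  qed (simp_all add: mult.assoc)
qed (simp_all add: distrib_left distrib_right)


section \<open>The algebra $U'_q({\rm so}_n)$\<close>

text \<open>The generator $I_{j,j-1}$, for \<open>2 \<le> j \<le> n\<close>, is indexed by \<open>j\<close>.\<close>

definition so_relators :: "complex \<Rightarrow> nat \<Rightarrow> nat free set" where
  "so_relators q n =
     {gen i ^ 2 * gen (i + 1) - const (q + inverse q) * gen i * gen (i + 1) * gen i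
        + gen (i + 1) * gen i ^ 2 - (- gen (i + 1)) | i. 2 \<le> i \<and> i + 1 \<le> n} \<union>
     {gen i * gen (i + 1) ^ 2 - const (q + inverse q) * gen (i + 1) * gen i * gen (i + 1)
        + gen (i + 1) ^ 2 * gen i - (- gen i) | i. 2 \<le> i \<and> i + 1 \<le> n} \<union>
     {gen i * gen j - gen j * gen i | i j.
        i \<in> {2..n} \<and> j \<in> {2..n} \<and> \<bar>int i - int j\<bar> > 1}"

definition so_ideal :: "complex \<Rightarrow> nat \<Rightarrow> nat free set" where
  "so_ideal q n = genideal (free_algebra {2..n}) (so_relators q n)"

definition Uso :: "complex \<Rightarrow> nat \<Rightarrow> nat free set ring" where
  "Uso q n = free_algebra {2..n} Quot so_ideal q n"

definition Uso_class :: "complex \<Rightarrow> nat \<Rightarrow> nat free \<Rightarrow> nat free set" where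
  "Uso_class q n p = so_ideal q n +>\<^bsub>free_algebra {2..n}\<^esub> p"

abbreviation Uso_gen :: "complex \<Rightarrow> nat \<Rightarrow> nat \<Rightarrow> nat free set" where
  "Uso_gen q n j \<equiv> Uso_class q n (gen j)"

lemma so_relators_subset: "so_relators q n \<subseteq> carrier (free_algebra {2..n})"
  unfolding so_relators_def power2_eq_square
  by (intro Un_least subsetI; elim CollectE exE conjE; hypsubst)
    (intro add_closed diff_closed uminus_closed mult_closed const_closed gen_closed; simp)+

lemma ideal_so_ideal: "ideal (so_ideal q n) (free_algebra {2..n})"
  unfolding so_ideal_def
  by (intro ring.genideal_ideal ring_free_algebra so_relators_subset)

lemma ring_Uso: "ring (Uso q n)"
  unfolding Uso_def by (rule ideal.quotient_is_ring[OF ideal_so_ideal])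


section \<open>Representations\<close>

definition End_ring :: "(complex \<Rightarrow> 'v \<Rightarrow> 'v) \<Rightarrow> ('v::ab_group_add \<Rightarrow> 'v) ring" where
  "End_ring scale =
    \<lparr>carrier = {f. Vector_Spaces.linear scale scale f},
     mult = (\<circ>), one = id, zero = (\<lambda>v. 0), add = (\<lambda>f g v. f v + g v)\<rparr>"

text \<open>
  A unital ring homomorphism is a homomorphism of complex algebras iff it sends
  \<open>c \<cdot> 1\<close> to \<open>c \<cdot> id\<close> for every scalar \<open>c\<close>.
\<close>

definition Uso_rep ::
  "complex \<Rightarrow> nat \<Rightarrow> (complex \<Rightarrow> 'v \<Rightarrow> 'v) \<Rightarrow> (nat free set \<Rightarrow> 'v::ab_group_add \<Rightarrow> 'v) \<Rightarrow> bool"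
where
  "Uso_rep q n scale T \<longleftrightarrow>
     vector_space scale \<and>
     T \<in> ring_hom (Uso q n) (End_ring scale) \<and>
     (\<forall>c. T (Uso_class q n (const c)) = scale c)"

definition finite_dimensional :: "(complex \<Rightarrow> 'v \<Rightarrow> 'v::ab_group_add) \<Rightarrow> bool" where
  "finite_dimensional scale \<longleftrightarrow> (\<exists>B. finite B \<and> module.span scale B = UNIV)"

definition Uso_irreducible ::
  "complex \<Rightarrow> nat \<Rightarrow> (complex \<Rightarrow> 'v \<Rightarrow> 'v) \<Rightarrow> (nat free set \<Rightarrow> 'v::ab_group_add \<Rightarrow> 'v) \<Rightarrow> bool"
where
  "Uso_irreducible q n scale T \<longleftrightarrow>
     (UNIV :: 'v set) \<noteq> {0} \<and>
     (\<forall>W. module.subspace scale W \<and> (\<forall>x\<in>carrier (Uso q n). T x ` W \<subseteq> W)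
        \<longrightarrow> W = {0} \<or> W = UNIV)"


section \<open>Eigenvalues and their types\<close>

definition eigenvalue_of ::
  "(complex \<Rightarrow> 'v \<Rightarrow> 'v) \<Rightarrow> ('v::zero \<Rightarrow> 'v) \<Rightarrow> complex \<Rightarrow> bool" where
  "eigenvalue_of scale f \<mu> \<longleftrightarrow> (\<exists>v. v \<noteq> 0 \<and> f v = scale \<mu> v)"

text \<open>
  Below \<open>s\<close> is the chosen square root of \<open>q\<close>, and a half-integer \<open>m\<close> is encoded by the
  integer \<open>l = 2 m\<close>, so that $q^m$ is \<open>s powi l\<close>, and \<open>m \<in> 1/2 + \<int>\<close> means that \<open>l\<close> is odd.
\<close>

definition qnum :: "complex \<Rightarrow> complex \<Rightarrow> int \<Rightarrow> complex" where
  "qnum q s l = (s powi l - s powi (- l)) / (q - inverse q)"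

definition qnum_plus :: "complex \<Rightarrow> complex \<Rightarrow> int \<Rightarrow> complex" where
  "qnum_plus q s l = (s powi l + s powi (- l)) / (q - inverse q)"

definition classical_type :: "complex \<Rightarrow> complex \<Rightarrow> complex \<Rightarrow> bool" where
  "classical_type q s \<mu> \<longleftrightarrow> (\<exists>l. \<mu> = \<i> * qnum q s l)"

definition nonclassical_type :: "complex \<Rightarrow> complex \<Rightarrow> complex \<Rightarrow> bool" where
  "nonclassical_type q s \<mu> \<longleftrightarrow>
     (\<exists>l. odd l \<and> (\<mu> = qnum_plus q s l \<or> \<mu> = - qnum_plus q s l))"

end

theory Submission
  imports Defs "HOL-Computational_Algebra.Fundamental_Theorem_Algebra"
begin

text \<open>
  Write an eigenvalue of \<open>A\<close>, for two neighbouring generators \<open>A, B\<close>, as \<open>lam q x\<close>. Multiplying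
  \<open>B v\<close>, for an eigenvector \<open>v\<close>, by a suitable linear polynomial in \<open>A\<close> moves \<open>x\<close> to \<open>q x\<close>, so by
  finite dimensionality one reaches an eigenvector \<open>w\<close>, at \<open>x = t\<close> say, with \<open>B w\<close> in the
  eigenspace at \<open>t / q\<close>. Then \<open>A\<close> acts on the vectors \<open>f(B) w\<close> by a \<open>q\<close>-difference operator in \<open>y\<close>,
  where \<open>f\<close> is a polynomial in \<open>lam q y\<close>. The minimal polynomial of \<open>B\<close> on \<open>w\<close> generates an
  invariant ideal, and its zeros therefore form finite \<open>q\<close>-strings starting and ending at points
  with \<open>y\<^sup>2 = t\<^sup>2\<close> and \<open>y\<^sup>2 = 1/t\<^sup>2\<close>; this makes \<open>t\<^sup>2\<close> an integer power of \<open>q\<close> (classical type) or minus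
  an odd power (nonclassical type), and in the first case the zeros are classical eigenvalues of
  \<open>B\<close>. On a module over the whole algebra the generalised eigenvectors of one generator with
  classical eigenvalues form a submodule, so irreducibility makes all or none of its eigenvalues
  classical, and this passes from each generator to its neighbours.
\<close>

section \<open>Deformed eigenvalues and their zeros\<close>

text \<open>
  In the notation of the paper \<open>lam q (q^m)\<close> is \<open>\<i>[m]\<^sub>q\<close>, while \<open>[m]\<^sub>+\<close> and \<open>-[m]\<^sub>+\<close>
  arise from \<open>x = \<plusminus>\<i> q^m\<close>.
\<close>

definition lam :: "complex \<Rightarrow> complex \<Rightarrow> complex" where
  "lam q x = \<i> * (x - inverse x) / (q - inverse q)"

lemma inverse_neq_self:
  fixes q :: complex
  assumes "q \<noteq> 0" "q ^ 2 \<noteq> 1"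
  shows "q - inverse q \<noteq> 0"
  using assms by (auto simp: power2_eq_square field_simps)

text \<open>With \<open>lam_shift_mult\<close> this makes the neighbours
  \<open>lam q (q * x)\<close> and \<open>lam q (x / q)\<close> the two roots of the quadratic that
  the cubic relation imposes on \<open>A\<close> at \<open>B v\<close>, for \<open>v\<close> an
  eigenvector at \<open>lam q x\<close>.\<close>

lemma lam_shift_add:
  assumes "q \<noteq> 0" "x \<noteq> 0"
  shows "lam q (q * x) + lam q (x / q) = (q + inverse q) * lam q x"
  using assms unfolding lam_def by (simp add: divide_simps) (simp add: algebra_simps)

lemma lam_shift_mult:
  assumes "q \<noteq> 0" "q ^ 2 \<noteq> 1" "x \<noteq> 0"
  shows "lam q (q * x) * lam q (x / q) = lam q x ^ 2 + 1"
proof -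
  define k where "k = q - inverse q"
  have k: "k \<noteq> 0" using inverse_neq_self assms by (simp add: k_def)
  have "(\<i> * (q * x - inverse (q * x))) * (\<i> * (x / q - inverse (x / q)))
      = (\<i> * (x - inverse x)) ^ 2 + k ^ 2"
    using assms unfolding k_def
    by (simp add: power2_eq_square divide_simps) (simp add: algebra_simps)
  then show ?thesis
    unfolding lam_def k_def[symmetric] using k
    by (simp add: field_simps power2_eq_square)
qed

text \<open>The factor that must be divided out of the q-difference operator; it vanishes only where
  y^2 = -1.\<close>

lemma lam_shift_diff:
  assumes "q \<noteq> 0" "q ^ 2 \<noteq> 1" "y \<noteq> 0"
  shows "lam q (q * y) - lam q (y / q) = \<i> * (y + inverse y)"
proof -
  define k where "k = q - inverse q"
  have k: "k \<noteq> 0" using inverse_neq_self assms by (simp add: k_def)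
  have "\<i> * (q * y - inverse (q * y)) - \<i> * (y / q - inverse (y / q))
      = \<i> * (y + inverse y) * k"
    using assms unfolding k_def by (simp add: divide_simps) (simp add: algebra_simps)
  moreover have "lam q (q * y) - lam q (y / q)
      = (\<i> * (q * y - inverse (q * y)) - \<i> * (y / q - inverse (y / q))) / k"
    unfolding lam_def k_def[symmetric] by (simp only: diff_divide_distrib)
  ultimately have "lam q (q * y) - lam q (y / q) = \<i> * (y + inverse y) * k / k"
    by (simp only:)
  then show ?thesis using k by simp
qed

text \<open>Coefficient of the upward shift in the q-difference operator; the factored form shows
  that it vanishes only at y = t and y = -t.\<close>

lemma lam_shift_cross:
  assumes "q \<noteq> 0" "q ^ 2 \<noteq> 1" "y \<noteq> 0" "t \<noteq> 0"
  shows "lam q (t / q) * lam q y - lam q t * lam q (y / q) = (y / t - t / y) / (q - inverse q)"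
proof -
  define k where "k = q - inverse q"
  have k: "k \<noteq> 0" using inverse_neq_self assms by (simp add: k_def)
  have "(\<i> * (t / q - inverse (t / q))) * (\<i> * (y - inverse y))
      - (\<i> * (t - inverse t)) * (\<i> * (y / q - inverse (y / q))) = (y / t - t / y) * k"
    using assms unfolding k_def by (simp add: divide_simps) (simp add: algebra_simps)
  moreover have "lam q (t / q) * lam q y - lam q t * lam q (y / q)
      = ((\<i> * (t / q - inverse (t / q))) * (\<i> * (y - inverse y))
        - (\<i> * (t - inverse t)) * (\<i> * (y / q - inverse (y / q)))) / (k * k)"
    unfolding lam_def k_def[symmetric] by (simp only: times_divide_times_eq diff_divide_distrib)
  ultimately have "lam q (t / q) * lam q y - lam q t * lam q (y / q)
      = (y / t - t / y) * k / (k * k)"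
    by (simp only:)
  then show ?thesis using k unfolding k_def[symmetric] by simp
qed

text \<open>Clearing denominators in \<open>lam q y = z\<close> leaves a monic quadratic with
  constant term -1, so its roots are nonzero.\<close>

lemma lam_surj:
  assumes "q \<noteq> 0" "q ^ 2 \<noteq> 1"
  obtains y where "y \<noteq> 0" "lam q y = z"
proof -
  define k where "k = q - inverse q"
  have k: "k \<noteq> 0" using inverse_neq_self assms by (simp add: k_def)
  obtain y where y: "poly [:-1, \<i> * z * k, 1:] y = 0"
    using fundamental_theorem_of_algebra_alt[of "[:-1, \<i> * z * k, 1:]"] by fastforce
  then have "y * (\<i> * z * k + y) = 1" by (simp add: algebra_simps)
  then have "y \<noteq> 0" "\<i> * z * k + y = inverse y"
    by (auto simp: inverse_unique)
  then have "y - inverse y = - (\<i> * z * k)"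
    by (metis add.commute add_diff_cancel_left' minus_diff_eq)
  then have "lam q y = z"
    unfolding lam_def k_def[symmetric] using k by simp
  with \<open>y \<noteq> 0\<close> show ?thesis by (rule that)
qed

lemma lam_uminus_inverse: "lam q (- inverse x) = lam q x"
  by (simp add: lam_def)

text \<open>Each root of \<open>P\<close> has at most two preimages under \<open>lam q\<close>. For
  q not a root of unity this forbids zeros along a whole orbit y, q y, q^2 y and so on.\<close>

lemma finite_lam_zeros:
  assumes "q \<noteq> 0" "q ^ 2 \<noteq> 1" "P \<noteq> 0"
  shows "finite {y. y \<noteq> 0 \<and> poly P (lam q y) = 0}"
proof -
  define k where "k = q - inverse q"
  have k: "k \<noteq> 0" using inverse_neq_self assms by (simp add: k_def)
  have "{y. y \<noteq> 0 \<and> poly P (lam q y) = 0}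
      \<subseteq> (\<Union>z\<in>{z. poly P z = 0}. {y. poly [:-1, \<i> * z * k, 1:] y = 0})"
  proof clarify
    fix y assume y: "y \<noteq> 0" "poly P (lam q y) = 0"
    have "poly [:-1, \<i> * lam q y * k, 1:] y = 0"
      using y k unfolding lam_def k_def[symmetric] by (simp add: field_simps)
    then show "y \<in> (\<Union>z\<in>{z. poly P z = 0}. {y. poly [:-1, \<i> * z * k, 1:] y = 0})"
      using y by blast
  qed
  moreover have "finite {y. poly [:-1, \<i> * z * k, 1:] y = 0}" for z
    by (rule poly_roots_finite) simp
  ultimately show ?thesis
    using poly_roots_finite[OF assms(3)] by (meson finite_UN_I finite_subset)
qed

lemma has_field_derivative_lam:
  assumes "y \<noteq> 0"
  shows "(lam q has_field_derivative \<i> * (1 + inverse (y ^ 2)) / (q - inverse q)) (at y)"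
  unfolding lam_def[abs_def] using assms
  by (auto intro!: derivative_eq_intros simp: power2_eq_square divide_inverse)

lemma power_inj_of_not_root_of_unity:
  fixes q :: complex
  assumes "q \<noteq> 0" "\<forall>m::nat. m > 0 \<longrightarrow> q ^ m \<noteq> 1" "q ^ a = q ^ b"
  shows "a = b"
proof -
  have le: "a = b" if "a \<le> b" "q ^ a = q ^ b" for a b
  proof -
    have "q ^ b = q ^ a * q ^ (b - a)" using that(1) by (simp add: power_add[symmetric])
    then have "q ^ (b - a) = 1" using assms(1) that(2) by simp
    then show ?thesis using assms(2) that(1) by (metis diff_is_0_eq le_antisym not_gr_zero)
  qed
  show ?thesis using le[of a b] le[of b a] assms(3) by (cases "a \<le> b") auto
qed

text \<open>
  The zeros of \<open>y \<mapsto> P (lam q y)\<close> are stable under \<open>y \<mapsto> -1/y\<close> and, by the functional equation,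
  under multiplication by \<open>q\<close> except at \<open>y = \<plusminus>t\<close>; being finite in number, they run into
  \<open>\<plusminus>t\<close> from both ends. The points \<open>\<plusminus>\<i>\<close> are ramification points of \<open>lam q\<close>, hence double
  zeros if they are zeros; a double zero survives the passage through \<open>\<plusminus>t\<close> as a zero, so that
  \<open>t\<^sup>2\<close> cannot be \<open>- q ^ (2 * M)\<close>.
\<close>

lemma zero_strings:
  assumes q: "q \<noteq> 0" "\<forall>m::nat. m > 0 \<longrightarrow> q ^ m \<noteq> 1" and t: "t \<noteq> 0" and P: "P \<noteq> 0"
    and R: "\<And>y. y \<noteq> 0 \<Longrightarrow> \<exists>D. (R has_field_derivative D) (at y)"
    and feq: "\<And>y. y \<noteq> 0 \<Longrightarrow> (y / t - t / y) * poly P (lam q (q * y)) = poly P (lam q y) * R y"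
    and y1: "y1 \<noteq> 0" "poly P (lam q y1) = 0"
  shows "(\<exists>l::int. t ^ 2 = q powi l \<and> (\<exists>l'::int. y1 ^ 2 = q powi l')) \<or>
         (\<exists>l::int. odd l \<and> t ^ 2 = - (q powi l))"
proof -
  define F where "F y = poly P (lam q y)" for y
  define F' where "F' y = poly (pderiv P) (lam q y) * (\<i> * (1 + inverse (y ^ 2)) / (q - inverse q))" for y
  have q2: "q ^ 2 \<noteq> 1" using q(2) by auto
  have F_inv: "F (- inverse y) = F y" for y
    by (simp add: F_def lam_uminus_inverse)
  have F_deriv: "(F has_field_derivative F' y) (at y)" if "y \<noteq> 0" for y
    unfolding F_def[abs_def] F'_def
    by (rule DERIV_chain2[OF poly_DERIV has_field_derivative_lam[OF that]])
  have inj: "inj (\<lambda>j. q ^ j * y)" if "y \<noteq> 0" for y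
    using that q power_inj_of_not_root_of_unity[of q] by (auto simp: inj_on_def)
  have infinite: False if "y \<noteq> 0" "\<And>j. F (q ^ j * y) = 0" for y
  proof -
    have "range (\<lambda>j. q ^ j * y) \<subseteq> {y. y \<noteq> 0 \<and> poly P (lam q y) = 0}"
      using that q by (auto simp: F_def)
    then show False
      using finite_lam_zeros[OF q(1) q2 P] inj[OF that(1)]
      by (meson finite_subset range_inj_infinite)
  qed
  have step: "F (q * y) = 0" if "y \<noteq> 0" "F y = 0" "y ^ 2 \<noteq> t ^ 2" for y
  proof -
    have "y / t - t / y \<noteq> 0"
      using that t by (auto simp: field_simps power2_eq_square)
    then show ?thesis using feq[OF that(1)] that(2) by (simp add: F_def)
  qed
  \<comment> \<open>The exponent is the first one at which the orbit hits t or -t; it exists because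
    \<open>step\<close> would otherwise give infinitely many zeros.\<close>
  have reach: "\<exists>a. (q ^ a * y) ^ 2 = t ^ 2 \<and> (\<forall>j\<le>a. F (q ^ j * y) = 0)"
    if y: "y \<noteq> 0" "F y = 0" for y
  proof -
    have zeros: "F (q ^ j * y) = 0" if "\<forall>i<j. (q ^ i * y) ^ 2 \<noteq> t ^ 2" for j
      using that
    proof (induction j)
      case (Suc j)
      then show ?case using step[of "q ^ j * y"] y q by (auto simp: mult.assoc)
    qed (use y in simp)
    have "\<exists>a. (q ^ a * y) ^ 2 = t ^ 2"
      using infinite[OF y(1)] zeros by blast
    then obtain a where "(q ^ a * y) ^ 2 = t ^ 2" "\<forall>i<a. (q ^ i * y) ^ 2 \<noteq> t ^ 2"
      using exists_least_iff[of "\<lambda>a. (q ^ a * y) ^ 2 = t ^ 2"] by blast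
    then show ?thesis using zeros by (intro exI[of _ a]) auto
  qed
  \<comment> \<open>This is the derivative of the left side of the functional equation; at a double
    zero of \<open>F\<close> the right side has derivative 0.\<close>
  have double: "(1 / t + t / y ^ 2) * F (q * y) + (y / t - t / y) * (q * F' (q * y)) = 0"
    if y: "y \<noteq> 0" "F y = 0" "F' y = 0" for y
  proof -
    obtain D where D: "(R has_field_derivative D) (at y)" using R y by blast
    have "((\<lambda>y. F y * R y) has_field_derivative 0) (at y)"
      using DERIV_mult[OF F_deriv[OF y(1)] D] y by simp
    moreover have "eventually (\<lambda>y. y \<noteq> 0) (nhds y)"
      using eventually_nhds_in_open[of "-{0}" y] y(1) by (simp add: open_Compl)
    then have "eventually (\<lambda>y. (y / t - t / y) * F (q * y) = F y * R y) (nhds y)"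
      by (rule eventually_mono) (use feq in \<open>simp add: F_def\<close>)
    ultimately have 1: "((\<lambda>y. (y / t - t / y) * F (q * y)) has_field_derivative 0) (at y)"
      by (subst DERIV_cong_ev[OF refl _ refl])
    have 2: "((\<lambda>y. F (q * y)) has_field_derivative F' (q * y) * q) (at y)"
      by (rule DERIV_chain2[OF F_deriv]) (use y q in \<open>auto intro!: derivative_eq_intros\<close>)
    have 3: "((\<lambda>y. y / t - t / y) has_field_derivative (1 / t + t / y ^ 2)) (at y)"
      using y t by (auto intro!: derivative_eq_intros simp: power2_eq_square)
    show ?thesis
      using DERIV_unique[OF 1 DERIV_mult[OF 3 2]] by (simp add: algebra_simps)
  qed
  \<comment> \<open>Strings are followed from \<open>y1\<close> and from -1/y1, which is also a
    zero. Multiplying the two resulting equations eliminates \<open>y1\<close> and gives t^4 =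
    q^(2(a+b)).\<close>
  obtain a where a: "(q ^ a * y1) ^ 2 = t ^ 2" "\<forall>j\<le>a. F (q ^ j * y1) = 0"
    using reach[of y1] y1 by (auto simp: F_def)
  obtain b where b: "(q ^ b * (- inverse y1)) ^ 2 = t ^ 2" "\<forall>j\<le>b. F (q ^ j * (- inverse y1)) = 0"
    using reach[of "- inverse y1"] y1 F_inv[of y1] by (auto simp: F_def)
  have ya: "q ^ (2 * a) * y1 ^ 2 = t ^ 2"
    using a(1) by (simp add: power_mult_distrib power_mult power2_eq_square mult_ac)
  have yb: "q ^ (2 * b) = t ^ 2 * y1 ^ 2"
    using b(1) y1 by (simp add: power_mult_distrib power_mult power2_eq_square field_simps)
  have "t ^ 2 * t ^ 2 = q ^ (2 * a) * q ^ (2 * b)"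
    using ya yb by (metis mult.assoc mult.commute)
  also have "\<dots> = (q ^ (a + b)) ^ 2"
    by (simp add: power_add[symmetric] power_mult[symmetric] mult.commute)
  finally have "(t ^ 2) ^ 2 = (q ^ (a + b)) ^ 2"
    by (simp only: power2_eq_square)
  then consider "t ^ 2 = q ^ (a + b)" | "t ^ 2 = - (q ^ (a + b))" "odd (a + b)"
    | "t ^ 2 = - (q ^ (a + b))" "even (a + b)"
    using power2_eq_iff by blast
  then show ?thesis
  proof cases
    case 1
    have "y1 ^ 2 = q powi (int b - int a)"
      using ya 1 q by (simp add: power_int_diff power_add power_mult power2_eq_square field_simps)
    moreover have "t ^ 2 = q powi int (a + b)"
      using 1 by (simp only: power_int_of_nat)
    ultimately show ?thesis by blast
  next
    case 2
    then show ?thesis by (intro disjI2 exI[of _ "int (a + b)"]) (simp only: power_int_of_nat, simp)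
  next
    case 3
    \<comment> \<open>Stated for arbitrary y with b \<le> a, so that it serves \<open>y1\<close>
      and, with a and b exchanged, -1/y1.\<close>
    have no_even: False
      if y: "y \<noteq> 0" and z: "\<forall>j\<le>a. F (q ^ j * y) = 0" and ya: "q ^ (2 * a) * y ^ 2 = t ^ 2"
        and ab: "b \<le> a" and ev: "even (a + b)" and tm: "t ^ 2 = - (q ^ (a + b))" for y a b
    proof -
      \<comment> \<open>The choice 2c = a - b puts the zero \<open>y0\<close> at a ramification
        point, y0^2 = -1, where \<open>F'\<close> vanishes too; t or -t lies M steps further
        on.\<close>
      define c where "c = (a - b) div 2"
      define M where "M = (a + b) div 2"
      have a_eq: "a = c + M" and ab_eq: "a + b = 2 * M" using ab ev unfolding c_def M_def by presburger+
      define y0 where "y0 = q ^ c * y"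
      have y0: "y0 \<noteq> 0" "F y0 = 0" using y q z a_eq by (auto simp: y0_def)
      have tM: "t ^ 2 = - (q ^ (2 * M))" using tm ab_eq by simp
      have "q ^ (2 * M) * y0 ^ 2 = t ^ 2"
        using ya unfolding a_eq y0_def by (simp add: power_add power_mult_distrib power_mult[symmetric] mult_ac)
      then have "q ^ (2 * M) * y0 ^ 2 = q ^ (2 * M) * (-1)" using tM by simp
      then have sq: "y0 ^ 2 = -1" using q(1) by (simp only: mult_cancel_left power_not_zero simp_thms)
      have F'0: "F' y0 = 0" by (simp add: F'_def sq)
      have *: "(q ^ j * y0) ^ 2 = t ^ 2 \<longleftrightarrow> j = M" for j
        using power_inj_of_not_root_of_unity[of q "2 * j" "2 * M"] q
        by (auto simp: power_mult_distrib sq tM power_mult[symmetric] mult.commute)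
      have low: "F (q ^ j * y0) = 0 \<and> F' (q ^ j * y0) = 0" if "j \<le> M" for j
        using that
      proof (induction j)
        case (Suc j)
        let ?y = "q ^ j * y0"
        have y: "?y \<noteq> 0" "F ?y = 0" "F' ?y = 0" "?y ^ 2 \<noteq> t ^ 2"
          using Suc y0 q * by auto
        have F: "F (q * ?y) = 0" using step y by blast
        moreover have "?y / t - t / ?y \<noteq> 0"
          using y(1,4) t by (auto simp: field_simps power2_eq_square)
        ultimately have "F' (q * ?y) = 0" using double[OF y(1-3)] q by simp
        with F show ?case by (simp add: mult.assoc)
      qed (use y0 F'0 in simp)
      \<comment> \<open>At exponent M the coefficient y/t - t/y vanishes but its derivative 2/t does
        not, so \<open>double\<close> still yields a zero one step later. Beyond that the orbit
        never meets t or -t again.\<close>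
      have high: "F (q ^ (Suc M + j) * y0) = 0" for j
      proof (induction j)
        case 0
        let ?y = "q ^ M * y0"
        have y: "?y \<noteq> 0" "F ?y = 0" "F' ?y = 0" "?y ^ 2 = t ^ 2"
          using low y0 q * by auto
        have "1 / t + t / ?y ^ 2 = 2 / t"
          unfolding y(4) using t by (simp add: power2_eq_square)
        moreover have "?y / t - t / ?y = 0"
          using y(1,4) t by (simp add: frac_eq_eq power2_eq_square[symmetric])
        ultimately have "F (q * ?y) = 0" using double[OF y(1-3)] t by simp
        then show ?case by (simp add: mult.assoc)
      next
        case (Suc j)
        then show ?case using step[of "q ^ (Suc M + j) * y0"] y0 q *[of "Suc M + j"]
          by (simp add: mult.assoc)
      qed
      have "F (q ^ j * y0) = 0" for j
        using low[of j] high[of "j - Suc M"] by (cases "j \<le> M") auto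
      then show False using infinite y0 by blast
    qed
    have yb': "q ^ (2 * b) * (- inverse y1) ^ 2 = t ^ 2"
      using yb y1 by (simp add: power_mult_distrib field_simps)
    have False
    proof (cases "b \<le> a")
      case True
      then show ?thesis using no_even[OF y1(1) a(2) ya] 3 by blast
    next
      case False
      then show ?thesis using no_even[OF _ b(2) yb', of a] 3 y1 by (simp add: add.commute)
    qed
    then show ?thesis ..
  qed
qed

section \<open>Polynomials in an operator\<close>

locale complex_space = vector_space scale
  for scale :: "complex \<Rightarrow> 'v::ab_group_add \<Rightarrow> 'v" (infixr \<open>*s\<close> 75)
begin

text \<open>Horner's scheme for p(f) v.\<close>

definition apply_poly :: "('v \<Rightarrow> 'v) \<Rightarrow> complex poly \<Rightarrow> 'v \<Rightarrow> 'v" where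
  "apply_poly f p v = fold_coeffs (\<lambda>a u. a *s v + f u) p 0"

context
  fixes f :: "'v \<Rightarrow> 'v"
  assumes f: "Vector_Spaces.linear scale scale f"
begin

interpretation f: Vector_Spaces.linear scale scale f by (rule f)

lemma apply_poly_0 [simp]: "apply_poly f 0 v = 0"
  by (simp add: apply_poly_def)

lemma apply_poly_pCons [simp]: "apply_poly f (pCons a p) v = a *s v + f (apply_poly f p v)"
  by (cases "p = 0 \<and> a = 0") (auto simp: apply_poly_def f.zero)

lemma apply_poly_add: "apply_poly f (p + r) v = apply_poly f p v + apply_poly f r v"
  by (induction p r rule: poly_induct2) (simp_all add: f.add scale_left_distrib)

lemma apply_poly_smult: "apply_poly f (smult c p) v = c *s apply_poly f p v"
  by (induction p) (simp_all add: f.scale scale_right_distrib)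

lemma apply_poly_diff: "apply_poly f (p - r) v = apply_poly f p v - apply_poly f r v"
  by (induction p r rule: poly_induct2) (simp_all add: f.diff scale_left_diff_distrib)

lemma apply_poly_zero_right [simp]: "apply_poly f p 0 = 0"
  by (induction p) (simp_all add: f.zero)

lemma apply_poly_mult: "apply_poly f (p * r) v = apply_poly f p (apply_poly f r v)"
  by (induction p) (simp_all add: apply_poly_add apply_poly_smult)

lemma apply_poly_add_right: "apply_poly f p (u + v) = apply_poly f p u + apply_poly f p v"
  by (induction p) (simp_all add: f.add scale_right_distrib)

lemma apply_poly_scale_right: "apply_poly f p (c *s v) = c *s apply_poly f p v"
  by (induction p) (simp_all add: f.scale scale_right_distrib mult.commute)

lemma apply_poly_monom: "apply_poly f (monom c n) v = c *s (f ^^ n) v"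
  by (induction n) (simp_all add: monom_0 monom_Suc f.zero f.scale)

lemma apply_poly_sum: "apply_poly f (sum p I) v = (\<Sum>i\<in>I. apply_poly f (p i) v)"
  by (induction I rule: infinite_finite_induct) (simp_all add: apply_poly_add)

lemma apply_poly_eigenvector:
  assumes "f v = \<mu> *s v"
  shows "apply_poly f p v = poly p \<mu> *s v"
  by (induction p) (simp_all add: f.scale assms scale_left_distrib mult.commute)

text \<open>The iterates of v up to exponent \<open>card S\<close> are too many to be independent.
  Coinciding iterates are treated separately, because linear dependence of a set does not see
  repetitions.\<close>

lemma ex_apply_poly_eq_0:
  assumes "finite S" "span S = UNIV"
  shows "\<exists>p. p \<noteq> 0 \<and> apply_poly f p v = 0"
proof (cases "inj_on (\<lambda>i. (f ^^ i) v) {..card S}")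
  case False
  then obtain i j where ij: "i \<noteq> j" "(f ^^ i) v = (f ^^ j) v" unfolding inj_on_def by blast
  have "coeff (monom 1 i - monom 1 j :: complex poly) i = 1" using ij by simp
  then have "(monom 1 i - monom 1 j :: complex poly) \<noteq> 0" by fastforce
  moreover have "apply_poly f (monom 1 i - monom 1 j) v = 0"
    using ij by (simp add: apply_poly_diff apply_poly_monom)
  ultimately show ?thesis by blast
next
  case True
  let ?g = "\<lambda>i. (f ^^ i) v"
  have "\<not> independent (?g ` {..card S})"
    using independent_span_bound[OF assms(1), of "?g ` {..card S}"] assms(2)
      card_image[OF True] by auto
  then obtain u where u: "\<exists>w\<in>?g ` {..card S}. u w \<noteq> 0" "(\<Sum>w\<in>?g ` {..card S}. u w *s w) = 0"
    using dependent_finite[of "?g ` {..card S}"] by auto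
  define p where "p = (\<Sum>i\<le>card S. monom (u (?g i)) i)"
  have coeff_p: "coeff p i = u (?g i)" if "i \<le> card S" for i
    using that by (simp add: p_def coeff_sum)
  have "p \<noteq> 0" using u(1) coeff_p by force
  moreover have "apply_poly f p v = 0"
    using u(2) by (simp add: p_def apply_poly_sum apply_poly_monom sum.reindex[OF True])
  ultimately show ?thesis by blast
qed

text \<open>Multiply polynomials that kill the individual vectors of a finite spanning set;
  polynomials in f commute.\<close>

lemma ex_annihilating_poly:
  assumes "finite S" "span S = UNIV"
  shows "\<exists>p. p \<noteq> 0 \<and> (\<forall>v. apply_poly f p v = 0)"
proof -
  have "\<exists>p. p \<noteq> 0 \<and> (\<forall>v\<in>S'. apply_poly f p v = 0)" if "finite S'" for S'
    using that
  proof induction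
    case (insert x S')
    then obtain p where p: "p \<noteq> 0" "\<forall>v\<in>S'. apply_poly f p v = 0" by blast
    obtain r where r: "r \<noteq> 0" "apply_poly f r x = 0" using ex_apply_poly_eq_0[OF assms] by blast
    have "apply_poly f (p * r) x = 0" "\<forall>v\<in>S'. apply_poly f (r * p) v = 0"
      using p r by (simp_all add: apply_poly_mult)
    then show ?case using p(1) r(1)
      by (intro exI[of _ "p * r"]) (auto simp: mult.commute)
  qed (auto intro: exI[of _ 1])
  then obtain p where p: "p \<noteq> 0" "\<forall>v\<in>S. apply_poly f p v = 0" using assms(1) by blast
  have "apply_poly f p v = 0" if "v \<in> span S" for v
    using that
    by (induction rule: span_induct_alt) (simp_all add: apply_poly_add_right apply_poly_scale_right p)
  with p assms(2) show ?thesis by auto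
qed

end

end

locale fin_dim = complex_space scale
  for scale :: "complex \<Rightarrow> 'v::ab_group_add \<Rightarrow> 'v" (infixr \<open>*s\<close> 75) +
  assumes fin_dim: "finite_dimensional scale"
begin

text \<open>The annihilator of w is an ideal of polynomials; division with remainder shows that a
  nonzero member of least degree generates it.\<close>

lemma ex_minimal_poly:
  assumes f: "Vector_Spaces.linear scale scale f"
  obtains P where "P \<noteq> 0" "\<And>p. apply_poly f p w = 0 \<longleftrightarrow> P dvd p"
proof -
  obtain S where S: "finite S" "span S = UNIV"
    using fin_dim unfolding finite_dimensional_def by blast
  let ?K = "\<lambda>p. p \<noteq> 0 \<and> apply_poly f p w = 0"
  obtain P where P: "?K P" "\<And>p. ?K p \<Longrightarrow> degree P \<le> degree p"
    using ex_has_least_nat[of ?K _ degree] ex_apply_poly_eq_0[OF f S, of w] by blast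
  have "apply_poly f p w = 0 \<longleftrightarrow> P dvd p" for p
  proof
    assume p: "apply_poly f p w = 0"
    have "apply_poly f ((p div P) * P + p mod P) w = 0" using p by simp
    then have "apply_poly f (p mod P) w = 0"
      using P(1) by (simp only: apply_poly_add[OF f] apply_poly_mult[OF f])
        (simp add: apply_poly_zero_right[OF f])
    then have "p mod P = 0"
      using P degree_mod_less[of P p] by (metis not_le)
    then show "P dvd p" by auto
  next
    assume "P dvd p"
    then obtain r where "p = r * P" by (metis dvdE mult.commute)
    then show "apply_poly f p w = 0"
      using P by (simp add: apply_poly_mult[OF f] apply_poly_zero_right[OF f])
  qed
  then show ?thesis using that P(1) by blast
qed

text \<open>Split off the factor X - z; the cofactor applied to w is nonzero by minimality of P and
  is an eigenvector.\<close>

lemma eigenvalue_of_root: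
  assumes f: "Vector_Spaces.linear scale scale f" and P: "\<And>p. apply_poly f p w = 0 \<longleftrightarrow> P dvd p" "P \<noteq> 0"
    and z: "poly P z = 0"
  shows "eigenvalue_of scale f z"
proof -
  interpret f: Vector_Spaces.linear scale scale f by (rule f)
  obtain P1 where P1: "P = [:-z, 1:] * P1" using z poly_eq_0_iff_dvd by blast
  define v where "v = apply_poly f P1 w"
  have "P1 \<noteq> 0" using P(2) P1 by auto
  moreover from this have "degree P = Suc (degree P1)"
    unfolding P1 by (simp add: degree_mult_eq del: mult_pCons_left)
  ultimately have "\<not> P dvd P1" using dvd_imp_degree_le[of P P1] by auto
  then have "v \<noteq> 0" using P(1) by (simp add: v_def)
  have "apply_poly f [:-z, 1:] v = 0"
    using P(1)[of P] by (simp add: v_def P1 apply_poly_mult[OF f, symmetric])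
  then have "f v = z *s v"
    by (simp add: apply_poly_pCons[OF f] apply_poly_0[OF f] f.zero scale_minus_left)
  with \<open>v \<noteq> 0\<close> show ?thesis unfolding eigenvalue_of_def by blast
qed

lemma ex_eigenvalue:
  assumes f: "Vector_Spaces.linear scale scale f" and "(UNIV :: 'v set) \<noteq> {0}"
  obtains z where "eigenvalue_of scale f z"
proof -
  interpret f: Vector_Spaces.linear scale scale f by (rule f)
  obtain w :: 'v where w: "w \<noteq> 0" using assms(2) by auto
  obtain P where P: "P \<noteq> 0" "\<And>p. apply_poly f p w = 0 \<longleftrightarrow> P dvd p" using ex_minimal_poly[OF f] by blast
  have "\<not> P dvd 1"
    using w P(2)[of 1] by (auto simp: one_pCons apply_poly_pCons[OF f] apply_poly_0[OF f] f.zero)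
  then have "degree P \<noteq> 0" using P(1) is_unit_iff_degree by blast
  then obtain z where "poly P z = 0"
    using fundamental_theorem_of_algebra_alt by (metis degree_pCons_0)
  then show ?thesis using that eigenvalue_of_root[OF f P(2,1)] by blast
qed

end

section \<open>Pairs of operators with the cubic relations\<close>

text \<open>The assumptions are symmetric in \<open>A\<close> and \<open>B\<close>, so neighbouring
  generators may be used in either order.\<close>

locale serre_pair = fin_dim scale
  for scale :: "complex \<Rightarrow> 'v::ab_group_add \<Rightarrow> 'v" (infixr \<open>*s\<close> 75) +
  fixes q :: complex and A B :: "'v \<Rightarrow> 'v"
  assumes q0: "q \<noteq> 0" and not_root_of_unity: "\<forall>m::nat. m > 0 \<longrightarrow> q ^ m \<noteq> 1"
    and linear_A: "Vector_Spaces.linear scale scale A"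
    and linear_B: "Vector_Spaces.linear scale scale B"
    and serre_AB: "A (A (B v)) - (q + inverse q) *s A (B (A v)) + B (A (A v)) = - B v"
    and serre_BA: "B (B (A v)) - (q + inverse q) *s B (A (B v)) + A (B (B v)) = - A v"
begin

sublocale A: Vector_Spaces.linear scale scale A by (rule linear_A)
sublocale B: Vector_Spaces.linear scale scale B by (rule linear_B)

lemma q2: "q ^ 2 \<noteq> 1"
  using not_root_of_unity by auto

text \<open>On \<open>B v\<close> the relation \<open>serre_AB\<close> becomes (A - l)(A - m) B v =
  0, with l and m the two neighbours of the eigenvalue.\<close>

lemma raise_eigenvector:
  assumes x: "x \<noteq> 0" and v: "A v = lam q x *s v"
  defines "u \<equiv> A (B v) - lam q (x / q) *s B v"
  shows "A u = lam q (q * x) *s u"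
proof -
  define l m where "l = lam q (q * x)" and "m = lam q (x / q)"
  have "A (A (B v)) - ((q + inverse q) * lam q x) *s A (B v) + (lam q x ^ 2 + 1) *s B v = 0"
    using serre_AB[of v]
    by (simp add: v A.scale B.scale scale_left_distrib power2_eq_square algebra_simps)
  then have "A (A (B v)) = (l + m) *s A (B v) - (l * m) *s B v"
    using lam_shift_add[OF q0 x] lam_shift_mult[OF q0 q2 x]
    by (simp add: l_def m_def algebra_simps)
  then show ?thesis
    by (simp add: u_def l_def[symmetric] m_def[symmetric] A.diff A.scale algebra_simps)
qed

text \<open>If \<open>raise_eigenvector\<close> never produced 0, infinitely many eigenvalues of
  \<open>A\<close> would be roots of one nonzero polynomial annihilating \<open>A\<close>.\<close>

lemma ex_highest_weight_vector:
  assumes x: "x \<noteq> 0" and v: "v \<noteq> 0" "A v = lam q x *s v"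
  obtains a w where "w \<noteq> 0" "A w = lam q (q ^ a * x) *s w"
    "A (B w) = lam q (q ^ a * x / q) *s B w"
proof (rule ccontr)
  assume neg: "\<not> thesis"
  have ev: "\<exists>w. w \<noteq> 0 \<and> A w = lam q (q ^ j * x) *s w" for j
  proof (induction j)
    case (Suc j)
    then obtain w where w: "w \<noteq> 0" "A w = lam q (q ^ j * x) *s w" by blast
    define u where "u = A (B w) - lam q (q ^ j * x / q) *s B w"
    have "u \<noteq> 0" using neg that[OF w] by (auto simp: u_def)
    moreover have "A u = lam q (q ^ Suc j * x) *s u"
      using raise_eigenvector[OF _ w(2)] q0 x by (simp add: u_def mult.assoc)
    ultimately show ?case by blast
  qed (use v in auto)
  obtain p where p: "p \<noteq> 0" "\<And>v. apply_poly A p v = 0"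
    using ex_annihilating_poly[OF linear_A] fin_dim unfolding finite_dimensional_def by blast
  have "poly p (lam q (q ^ j * x)) = 0" for j
    using ev[of j] p(2) apply_poly_eigenvector[OF linear_A, where p = p] by force
  then have "range (\<lambda>j. q ^ j * x) \<subseteq> {y. y \<noteq> 0 \<and> poly p (lam q y) = 0}"
    using q0 x by auto
  moreover have "inj (\<lambda>j. q ^ j * x)"
    using x q0 not_root_of_unity power_inj_of_not_root_of_unity[of q] by (auto simp: inj_on_def)
  ultimately show False
    using finite_lam_zeros[OF q0 q2 p(1)] by (meson finite_subset range_inj_infinite)
qed

text \<open>
  On polynomials in \<open>z = lam q y\<close>, representing vectors \<open>f(B) w\<close> with \<open>w\<close> a highest weight vector,
  \<open>A\<close> acts as a \<open>q\<close>-difference operator in \<open>y\<close>.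
\<close>

lemma q_difference_operator:
  assumes w: "A w = lam q t *s w" "A (B w) = lam q (t / q) *s B w"
  shows "\<exists>g. apply_poly B g w = A (apply_poly B f w) \<and>
    (\<forall>y. y \<noteq> 0 \<longrightarrow> (lam q (q * y) - lam q (y / q)) * poly g (lam q y) =
      (lam q (t / q) * lam q y - lam q t * lam q (y / q)) * poly f (lam q (q * y)) +
      (lam q t * lam q (q * y) - lam q (t / q) * lam q y) * poly f (lam q (y / q)))"
    (is "\<exists>g. ?Q f g")
proof -
  note apply_poly_simps = apply_poly_0[OF linear_B] apply_poly_pCons[OF linear_B]
    apply_poly_add[OF linear_B] apply_poly_smult[OF linear_B] apply_poly_diff[OF linear_B]
  have zero: "?Q 0 0"
    by (simp add: apply_poly_simps A.zero)
  have add: "?Q (f + f') (g + g')" if "?Q f g" "?Q f' g'" for f f' g g'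
    using that by (simp add: apply_poly_simps A.add distrib_left add_ac)
  have const: "?Q [:c:] [:c * lam q t:]" for c
    by (simp add: apply_poly_simps A.scale A.zero B.zero w) (simp add: algebra_simps)
  have linear: "?Q [:0, c:] [:0, c * lam q (t / q):]" for c
    by (simp add: apply_poly_simps A.scale A.zero B.zero B.scale w) (simp add: algebra_simps)
  \<comment> \<open>Solving \<open>serre_BA\<close> for A B^2 v, with v = f(B) w, expresses the
    action on X^2 f through those on f and X f.\<close>
  have step: "?Q (pCons 0 (pCons 0 f)) (smult (q + inverse q) (pCons 0 g1) - pCons 0 (pCons 0 g) - g)"
    if g: "?Q f g" and g1: "?Q (pCons 0 f) g1" for f g g1
  proof (intro conjI allI impI)
    let ?g = "smult (q + inverse q) (pCons 0 g1) - pCons 0 (pCons 0 g) - g"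
    define v where "v = apply_poly B f w"
    have "apply_poly B ?g w = (q + inverse q) *s B (A (B v)) - B (B (A v)) - A v"
      using g g1 by (simp add: apply_poly_simps v_def B.diff B.scale)
    also have "\<dots> = A (B (B v))"
      using serre_BA[of v] by (simp add: algebra_simps eq_neg_iff_add_eq_0)
    finally show "apply_poly B ?g w = A (apply_poly B (pCons 0 (pCons 0 f)) w)"
      by (simp add: apply_poly_simps v_def)
  next
    let ?g = "smult (q + inverse q) (pCons 0 g1) - pCons 0 (pCons 0 g) - g"
    fix y :: complex assume y: "y \<noteq> 0"
    define l m z where "l = lam q (q * y)" and "m = lam q (y / q)" and "z = lam q y"
    define a b where "a = lam q (t / q) * z - lam q t * m" and "b = lam q t * l - lam q (t / q) * z"
    have sum: "(q + inverse q) * z = l + m" and prod: "z * z = l * m - 1"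
      using lam_shift_add[OF q0 y] lam_shift_mult[OF q0 q2 y]
      by (simp_all add: l_def m_def z_def power2_eq_square)
    have G: "(l - m) * poly g z = a * poly f l + b * poly f m"
      and G1: "(l - m) * poly g1 z = a * (l * poly f l) + b * (m * poly f m)"
      using g g1 y unfolding l_def m_def z_def a_def b_def by auto
    have "poly ?g z = ((q + inverse q) * z) * poly g1 z - (z * z + 1) * poly g z"
      by (simp add: algebra_simps)
    also have "\<dots> = (l + m) * poly g1 z - l * m * poly g z"
      by (simp add: sum prod)
    finally have *: "poly ?g z = (l + m) * poly g1 z - l * m * poly g z" .
    \<comment> \<open>Both shifted values satisfy Z^2 = (l + m) Z - l m, so the recursion turns the
      formulas for f and X f into the one for X^2 f.\<close>
    have "(l - m) * poly ?g z = (l + m) * ((l - m) * poly g1 z) - l * m * ((l - m) * poly g z)"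
      unfolding * by (simp only: algebra_simps)
    also have "\<dots> = a * (l * (l * poly f l)) + b * (m * (m * poly f m))"
      unfolding G G1 by (simp add: algebra_simps)
    finally show "(lam q (q * y) - lam q (y / q)) * poly ?g (lam q y) =
        (lam q (t / q) * lam q y - lam q t * lam q (y / q)) * poly (pCons 0 (pCons 0 f)) (lam q (q * y)) +
        (lam q t * lam q (q * y) - lam q (t / q) * lam q y) * poly (pCons 0 (pCons 0 f)) (lam q (y / q))"
      unfolding l_def m_def z_def a_def b_def by simp
  qed
  \<comment> \<open>The recursion has depth two, hence the simultaneous induction for f and X
    f.\<close>
  have "(\<exists>g. ?Q f g) \<and> (\<exists>g. ?Q (pCons 0 f) g)"
  proof (induction f)
    case 0
    show ?case unfolding pCons_0_0 by (rule conjI; rule exI; rule zero)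
  next
    case (pCons c f)
    then obtain g g1 where g: "?Q f g" "?Q (pCons 0 f) g1" by blast
    have 1: "pCons c f = [:c:] + pCons 0 f" "pCons 0 (pCons c f) = [:0, c:] + pCons 0 (pCons 0 f)"
      by simp_all
    show ?case
    proof
      show "\<exists>g. ?Q (pCons c f) g"
        unfolding 1(1) by (rule exI, rule add[OF const g(2)])
      show "\<exists>g. ?Q (pCons 0 (pCons c f)) g"
        unfolding 1(2) by (rule exI, rule add[OF linear step[OF g]])
    qed
  qed
  then show ?thesis ..
qed

text \<open>If p(B) w = 0 then also A p(B) w = 0, so the ideal generated by the minimal polynomial
  \<open>P\<close> is stable under the q-difference operator. Its images of \<open>P\<close> and X
  \<open>P\<close> together yield the functional equation of \<open>zero_strings\<close>.\<close>

lemma highest_weight: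
  assumes w: "w \<noteq> 0" "A w = lam q t *s w" "A (B w) = lam q (t / q) *s B w" and t: "t \<noteq> 0"
  shows "(\<exists>l::int. t ^ 2 = q powi l \<and>
           (\<exists>y l'::int. y \<noteq> 0 \<and> y ^ 2 = q powi l' \<and> eigenvalue_of scale B (lam q y))) \<or>
         (\<exists>l::int. odd l \<and> t ^ 2 = - (q powi l))"
proof -
  define k where "k = q - inverse q"
  have k: "k \<noteq> 0" using inverse_neq_self[OF q0 q2] by (simp add: k_def)
  obtain P where P: "P \<noteq> 0" "\<And>p. apply_poly B p w = 0 \<longleftrightarrow> P dvd p"
    using ex_minimal_poly[OF linear_B] by blast
  have PA: "P dvd g" if "apply_poly B g w = A (apply_poly B (f * P) w)" for f g
    using that P(2)[of "f * P"] P(2)[of g] by (simp add: A.zero)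
  obtain g1 where g1: "P dvd g1"
    "\<And>y. y \<noteq> 0 \<Longrightarrow> (lam q (q * y) - lam q (y / q)) * poly g1 (lam q y) =
      (lam q (t / q) * lam q y - lam q t * lam q (y / q)) * poly P (lam q (q * y)) +
      (lam q t * lam q (q * y) - lam q (t / q) * lam q y) * poly P (lam q (y / q))"
    using q_difference_operator[OF w(2,3), of P] PA[of _ 1] by auto
  obtain g2 where g2: "P dvd g2"
    "\<And>y. y \<noteq> 0 \<Longrightarrow> (lam q (q * y) - lam q (y / q)) * poly g2 (lam q y) =
      (lam q (t / q) * lam q y - lam q t * lam q (y / q)) * (lam q (q * y) * poly P (lam q (q * y))) +
      (lam q t * lam q (q * y) - lam q (t / q) * lam q y) * (lam q (y / q) * poly P (lam q (y / q)))"
    using q_difference_operator[OF w(2,3), of "[:0,1:] * P"] PA[of _ "[:0,1:]"] by auto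
  obtain r1 r2 where r: "g1 = P * r1" "g2 = P * r2" using g1(1) g2(1) by (elim dvdE)
  \<comment> \<open>Subtracting \<open>lam q (y / q)\<close> times the equation for \<open>P\<close>
    from that for X \<open>P\<close> removes the downward shift; the factor \<open>k\<close> clears
    the denominator in \<open>lam_shift_cross\<close>.\<close>
  define R where "R y = k * (poly r2 (lam q y) - lam q (y / q) * poly r1 (lam q y))" for y
  have R_deriv: "\<exists>D. (R has_field_derivative D) (at y)" if "y \<noteq> 0" for y
  proof -
    have "((\<lambda>y. lam q (y / q)) has_field_derivative
        \<i> * (1 + inverse ((y / q) ^ 2)) / (q - inverse q) * (1 / q)) (at y)"
      by (rule DERIV_chain2[OF has_field_derivative_lam]) 
        (use that q0 in \<open>auto intro!: derivative_eq_intros\<close>)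
    from DERIV_cmult[OF DERIV_diff[OF DERIV_chain2[OF poly_DERIV has_field_derivative_lam[OF that]]
        DERIV_mult[OF this DERIV_chain2[OF poly_DERIV has_field_derivative_lam[OF that]]]]]
    show ?thesis unfolding R_def[abs_def] by blast
  qed
  have feq0: "(y / t - t / y) * poly P (lam q (q * y)) = poly P (lam q y) * R y"
    if y: "y \<noteq> 0" "y ^ 2 \<noteq> -1" for y
  proof -
    define l m z where "l = lam q (q * y)" and "m = lam q (y / q)" and "z = lam q y"
    define a b where "a = lam q (t / q) * z - lam q t * m" and "b = lam q t * l - lam q (t / q) * z"
    have "y + inverse y \<noteq> 0"
      using y by (auto simp: field_simps power2_eq_square add_eq_0_iff)
    then have lm: "l - m \<noteq> 0"
      using lam_shift_diff[OF q0 q2 y(1)] by (simp add: l_def m_def)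
    have G1: "(l - m) * (poly P z * poly r1 z) = a * poly P l + b * poly P m"
      and G2: "(l - m) * (poly P z * poly r2 z) = a * (l * poly P l) + b * (m * poly P m)"
      using g1(2)[OF y(1)] g2(2)[OF y(1)] unfolding r l_def m_def z_def a_def b_def by simp_all
    have "(l - m) * (a * poly P l) = (l - m) * (poly P z * (poly r2 z - m * poly r1 z))"
      using G1 G2 by (simp add: right_diff_distrib mult.left_commute[of _ m]) (simp add: algebra_simps)
    then have "a * poly P l = poly P z * (poly r2 z - m * poly r1 z)"
      using lm by simp
    then have "a * k * poly P l = poly P z * R y"
      by (simp add: R_def l_def m_def z_def)
    moreover have "a * k = y / t - t / y"
      using lam_shift_cross[OF q0 q2 y(1) t] k by (simp add: a_def z_def m_def k_def[symmetric])
    ultimately show ?thesis by (simp add: l_def z_def)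
  qed
  have feq: "(y / t - t / y) * poly P (lam q (q * y)) = poly P (lam q y) * R y"
    if y: "y \<noteq> 0" for y
  proof -
    \<comment> \<open>Division by \<open>l - m\<close> excluded y^2 = -1; continuity recovers these
      points, since \<open>H\<close> vanishes on a punctured neighbourhood.\<close>
    define H where "H y = (y / t - t / y) * poly P (lam q (q * y)) - poly P (lam q y) * R y" for y
    have lam: "isCont (lam q) y" if "y \<noteq> 0" for y
      using has_field_derivative_lam[OF that] DERIV_isCont by blast
    have "isCont (\<lambda>y. lam q (q * y)) y"
      by (rule isCont_o2[OF _ lam]) (use y q0 in auto)
    moreover have "isCont R y" using R_deriv[OF y] DERIV_isCont by blast
    ultimately have "isCont H y"
      unfolding H_def[abs_def] using y t lam[OF y] by (intro continuous_intros) auto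
    then have lim: "(H \<longlongrightarrow> H y) (at y)" by (simp add: isCont_def)
    have "{x::complex. x ^ 2 = -1} \<subseteq> {\<i>, - \<i>}"
      using power2_eq_iff[of _ \<i>] by auto
    then have fin: "finite ({x::complex. x ^ 2 = -1} \<union> {0})"
      using finite_subset[of "{x::complex. x ^ 2 = -1}" "{\<i>, - \<i>}"] by simp
    define E where "E = ({x. x ^ 2 = -1} \<union> {0}) - {y}"
    have "finite E" using fin by (simp add: E_def)
    then have "open (- E)" by (intro open_Compl finite_imp_closed)
    then have "eventually (\<lambda>x. x \<in> - E) (nhds y)"
      by (rule eventually_nhds_in_open) (simp add: E_def)
    then have "eventually (\<lambda>x. H x = 0) (at y)"
      unfolding eventually_at_filter
      by (rule eventually_mono) (use feq0 in \<open>auto simp: H_def E_def\<close>)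
    then have "(H \<longlongrightarrow> 0) (at y)"
      by (rule tendsto_eventually)
    then have "H y = 0" by (rule tendsto_unique[OF at_neq_bot lim])
    then show ?thesis by (simp add: H_def)
  qed
  have "\<not> P dvd 1"
    using w(1) P(2)[of 1]
    by (auto simp: one_pCons apply_poly_pCons[OF linear_B] apply_poly_0[OF linear_B] B.zero)
  then have "degree P \<noteq> 0" using P(1) is_unit_iff_degree by blast
  then obtain z where z: "poly P z = 0"
    using fundamental_theorem_of_algebra_alt by (metis degree_pCons_0)
  obtain y where y: "y \<noteq> 0" "lam q y = z" using lam_surj[OF q0 q2] by blast
  then have "eigenvalue_of scale B (lam q y)"
    using eigenvalue_of_root[OF linear_B P(2,1) z] by simp
  then show ?thesis
    using zero_strings[OF q0 not_root_of_unity t P(1) R_deriv feq y(1)] z y by blast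
qed

end

section \<open>Classical and nonclassical eigenvalues\<close>

lemma lam_eq_qnum: "\<i> * qnum q s l = lam q (s powi l)"
  by (simp add: qnum_def lam_def power_int_minus)

lemma power_int_square:
  fixes s q :: complex
  assumes "s ^ 2 = q"
  shows "(s powi l) ^ 2 = q powi l"
  using assms power_int_mult[of s 2 l] power_int_mult[of s l 2] by (simp add: mult.commute)

text \<open>Working with x^2 leaves the sign of x open; the sign is harmless because x = -s^l may be
  replaced by -1/x = s^(-l), which has the same \<open>lam\<close>.\<close>

lemma classical_type_iff:
  assumes "s ^ 2 = q" "q \<noteq> 0"
  shows "classical_type q s \<mu> \<longleftrightarrow> (\<exists>x. \<exists>l::int. x \<noteq> 0 \<and> x ^ 2 = q powi l \<and> \<mu> = lam q x)"
proof
  assume "classical_type q s \<mu>"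
  then obtain l where l: "\<mu> = lam q (s powi l)"
    unfolding classical_type_def lam_eq_qnum by blast
  have "s \<noteq> 0" using assms by auto
  then show "\<exists>x. \<exists>l::int. x \<noteq> 0 \<and> x ^ 2 = q powi l \<and> \<mu> = lam q x"
    using l power_int_square[OF assms(1)] by (intro exI[of _ "s powi l"] exI[of _ l]) simp
next
  assume "\<exists>x. \<exists>l::int. x \<noteq> 0 \<and> x ^ 2 = q powi l \<and> \<mu> = lam q x"
  then obtain x and l :: int where x: "x \<noteq> 0" "x ^ 2 = (s powi l) ^ 2" "\<mu> = lam q x"
    using power_int_square[OF assms(1)] by metis
  then consider "x = s powi l" | "x = - (s powi l)" using power2_eq_iff by blast
  then have "\<exists>l'. lam q x = lam q (s powi l')"
  proof cases
    case 2
    then have "lam q x = lam q (s powi (- l))"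
      using lam_uminus_inverse[of q x] by (simp add: power_int_minus)
    then show ?thesis by blast
  qed blast
  then show "classical_type q s \<mu>"
    unfolding classical_type_def lam_eq_qnum using x(3) by simp
qed

text \<open>The square roots of -q^l are i s^l and its negative; they give the two signs in the
  nonclassical type.\<close>

lemma nonclassical_typeI:
  assumes "s ^ 2 = q" "x ^ 2 = - (q powi l)" "odd l"
  shows "nonclassical_type q s (lam q x)"
proof -
  have "x ^ 2 = (\<i> * s powi l) ^ 2"
    using assms(2) power_int_square[OF assms(1)] by (simp add: power_mult_distrib)
  then consider "x = \<i> * s powi l" | "x = - (\<i> * s powi l)" using power2_eq_iff by blast
  then have "\<i> * (x - inverse x) = - (s powi l + s powi (- l)) \<or>
      \<i> * (x - inverse x) = s powi l + s powi (- l)"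
    by cases (simp_all add: power_int_minus algebra_simps)
  then have "lam q x = - qnum_plus q s l \<or> lam q x = qnum_plus q s l"
    unfolding lam_def qnum_plus_def by (metis minus_divide_left)
  then show ?thesis using assms(3) unfolding nonclassical_type_def by blast
qed

lemma power_int_neq_uminus:
  fixes q :: complex
  assumes q: "q \<noteq> 0" "\<forall>m::nat. m > 0 \<longrightarrow> q ^ m \<noteq> 1"
  shows "q powi a \<noteq> - (q powi b)"
proof
  assume eq: "q powi a = - (q powi b)"
  have le: "a = b" if "a \<le> b" "q powi (2 * a) = q powi (2 * b)" for a b
  proof -
    have "q powi (2 * b) = q powi (2 * a) * q ^ nat (2 * (b - a))"
      using that(1) q(1) by (simp add: power_int_add[symmetric] flip: power_int_of_nat)
    then have "q ^ nat (2 * (b - a)) = 1" using that(2) q(1) by simp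
    then have "nat (2 * (b - a)) = 0" using q(2) by blast
    then show ?thesis using that(1) by simp
  qed
  have "q powi (2 * a) = (q powi a) ^ 2" "q powi (2 * b) = (q powi b) ^ 2"
    using power_int_mult[of q _ 2] by (simp_all add: mult.commute)
  then have "q powi (2 * a) = q powi (2 * b)" by (simp add: eq)
  then have "a = b" using le[of a b] le[of b a] by (cases "a \<le> b") auto
  then show False using eq q(1) by simp
qed

section \<open>Eigenvalue types in a pair of operators\<close>

context serre_pair
begin

text \<open>Passing to a highest weight vector multiplies x^2 by q^(2a), which preserves both its
  sign relative to powers of q and the parity of the exponent.\<close>

lemma eigenvalue_cases:
  assumes s: "s ^ 2 = q" and x: "x \<noteq> 0" and ev: "eigenvalue_of scale A (lam q x)"
  obtains (classical) l :: int and \<nu>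
    where "x ^ 2 = q powi l" "eigenvalue_of scale B \<nu>" "classical_type q s \<nu>"
  | (nonclassical) l :: int where "odd l" "x ^ 2 = - (q powi l)"
proof -
  obtain v where v: "v \<noteq> 0" "A v = lam q x *s v"
    using ev unfolding eigenvalue_of_def by blast
  obtain a w where w: "w \<noteq> 0" "A w = lam q (q ^ a * x) *s w"
    "A (B w) = lam q (q ^ a * x / q) *s B w"
    using ex_highest_weight_vector[OF x v] by blast
  have t: "(q ^ a * x) ^ 2 = q powi (2 * int a) * x ^ 2"
    using power_int_of_nat[of q "2 * a"] by (simp add: power_mult_distrib power_mult mult.commute)
  consider (c) l y and l' :: int where "(q ^ a * x) ^ 2 = q powi l" "y \<noteq> 0" "y ^ 2 = q powi l'"
      "eigenvalue_of scale B (lam q y)"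
    | (n) l where "odd l" "(q ^ a * x) ^ 2 = - (q powi l)"
    using highest_weight[OF w] x q0 by auto
  then show ?thesis
  proof cases
    case c
    have "x ^ 2 = q powi (l - 2 * int a)"
      using c(1) t q0 by (simp add: power_int_diff field_simps)
    moreover have "classical_type q s (lam q y)"
      using c(2,3) classical_type_iff[OF s q0] by blast
    ultimately show ?thesis using classical c(4) by blast
  next
    case n
    have "x ^ 2 = - (q powi (l - 2 * int a))"
      using n(2) t q0 by (simp add: power_int_diff field_simps)
    moreover have "odd (l - 2 * int a)" using n(1) by simp
    ultimately show ?thesis using nonclassical by blast
  qed
qed

lemma nonclassical_if_not_classical:
  assumes s: "s ^ 2 = q" and "eigenvalue_of scale A \<mu>" "\<not> classical_type q s \<mu>"
  shows "nonclassical_type q s \<mu>"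
proof -
  obtain x where x: "x \<noteq> 0" "lam q x = \<mu>" using lam_surj[OF q0 q2] by blast
  have "eigenvalue_of scale A (lam q x)" using assms(2) x(2) by simp
  from s x(1) this show ?thesis
  proof (cases rule: eigenvalue_cases)
    case classical
    then show ?thesis using assms(3) x classical_type_iff[OF s q0] by blast
  next
    case nonclassical
    then show ?thesis using nonclassical_typeI[OF s] x(2) by blast
  qed
qed

text \<open>The second alternative of \<open>eigenvalue_cases\<close> is impossible here, as no
  power of q is minus another.\<close>

lemma classical_eigenvalue_transfer:
  assumes s: "s ^ 2 = q" and "eigenvalue_of scale A \<mu>" "classical_type q s \<mu>"
  obtains \<nu> where "eigenvalue_of scale B \<nu>" "classical_type q s \<nu>"
proof -
  obtain x and l :: int where x: "x \<noteq> 0" "x ^ 2 = q powi l" "\<mu> = lam q x"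
    using assms(3) classical_type_iff[OF s q0] by blast
  have "eigenvalue_of scale A (lam q x)" using assms(2) x(3) by simp
  from s x(1) this show ?thesis
  proof (cases rule: eigenvalue_cases)
    case classical
    then show ?thesis using that by blast
  next
    case nonclassical
    then show ?thesis using x(2) power_int_neq_uminus[OF q0 not_root_of_unity] by metis
  qed
qed

end

section \<open>Sums of generalised eigenspaces\<close>

context complex_space
begin

text \<open>For linear f these are the vectors killed by some product of factors f - \<mu> with
  \<mu> in S. The inductive form provides induction on the number of factors.\<close>

inductive_set root_space :: "('v \<Rightarrow> 'v) \<Rightarrow> complex set \<Rightarrow> 'v set" for f S where
  zero: "0 \<in> root_space f S"
| step: "f v - \<mu> *s v \<in> root_space f S \<Longrightarrow> \<mu> \<in> S \<Longrightarrow> v \<in> root_space f S"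

text \<open>On the eigenvector each factor acts as the scalar \<nu> - \<mu>, so reaching 0 requires
  a factor with \<mu> = \<nu>.\<close>

lemma root_space_eigenvalue:
  assumes "v \<in> root_space f S" "Vector_Spaces.linear scale scale f" "v \<noteq> 0" "f v = \<nu> *s v"
  shows "\<nu> \<in> S"
  using assms(1,3,4)
proof induction
  case (step v \<mu>)
  interpret f: Vector_Spaces.linear scale scale f by (rule assms(2))
  have eq: "f v - \<mu> *s v = (\<nu> - \<mu>) *s v" using step.prems by (simp add: algebra_simps)
  show ?case
  proof (cases "\<nu> = \<mu>")
    case False
    then show ?thesis
      using step.IH step.prems unfolding eq by (simp add: f.scale mult.commute)
  qed (use step.hyps in simp)
qed simp

lemma eigenvector_in_root_space:
  assumes "f v = \<mu> *s v" "\<mu> \<in> S"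
  shows "v \<in> root_space f S"
  by (rule root_space.step[OF _ assms(2)]) (simp add: assms(1) root_space.zero)

lemma root_space_commute:
  assumes "v \<in> root_space f S" "Vector_Spaces.linear scale scale g" "\<And>v. f (g v) = g (f v)"
  shows "g v \<in> root_space f S"
  using assms(1)
proof induction
  interpret g: Vector_Spaces.linear scale scale g by (rule assms(2))
  case (step v \<mu>)
  have "f (g v) - \<mu> *s g v = g (f v - \<mu> *s v)"
    by (simp add: assms(3) g.diff g.scale)
  then show ?case using step root_space.step by metis
next
  interpret g: Vector_Spaces.linear scale scale g by (rule assms(2))
  case zero
  show ?case by (simp add: root_space.zero g.zero)
qed

lemma subspace_root_space:
  assumes f: "Vector_Spaces.linear scale scale f"
  shows "subspace (root_space f S)"
proof (rule subspaceI)
  interpret f: Vector_Spaces.linear scale scale f by (rule f)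
  show "0 \<in> root_space f S" by (rule root_space.zero)
  show "c *s v \<in> root_space f S" if "v \<in> root_space f S" for c v
    by (rule root_space_commute[OF that linear_scale_self]) (simp add: f.scale)
  show "u + v \<in> root_space f S" if "u \<in> root_space f S" "v \<in> root_space f S" for u v
    using that
  proof (induction arbitrary: v)
    case (step u \<mu>)
    \<comment> \<open>The factor chosen for u commutes with f, so applying it to v as well keeps v
      in the root space.\<close>
    have "Vector_Spaces.linear scale scale (\<lambda>v. f v - \<mu> *s v)"
      unfolding Vector_Spaces.linear_iff
      by (simp add: vector_space_axioms f.add f.scale algebra_simps)
    then have "f v - \<mu> *s v \<in> root_space f S"
      by (rule root_space_commute[OF step.prems]) (simp add: f.diff f.scale)
    from step.IH[OF this] have "f (u + v) - \<mu> *s (u + v) \<in> root_space f S"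
      by (simp add: f.add algebra_simps)
    then show ?case using step.hyps(2) by (rule root_space.step)
  qed simp
qed

end

text \<open>With v' = (A - \<mu>) v, the relation writes (A - l)(A - m) B v through
  \<open>A (B v')\<close>, \<open>B v'\<close> and \<open>B (A v')\<close>. These lie in the root
  space by induction, and l, m belong to S.\<close>

lemma (in serre_pair) root_space_invariant:
  assumes S: "\<And>\<mu>. \<mu> \<in> S \<Longrightarrow> \<exists>x. x \<noteq> 0 \<and> \<mu> = lam q x \<and> lam q (q * x) \<in> S \<and> lam q (x / q) \<in> S"
    and v: "v \<in> root_space A S"
  shows "B v \<in> root_space A S"
proof -
  \<comment> \<open>The second conjunct strengthens the induction, because \<open>B (A v')\<close>
    occurs in the relation.\<close>
  have "B v \<in> root_space A S \<and> B (A v) \<in> root_space A S"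
    using v
  proof induction
    case zero
    show ?case by (simp add: A.zero B.zero root_space.zero)
  next
    case (step v \<mu>)
    obtain x where x: "x \<noteq> 0" "\<mu> = lam q x" "lam q (q * x) \<in> S" "lam q (x / q) \<in> S"
      using S step.hyps by blast
    define l m where "l = lam q (q * x)" and "m = lam q (x / q)"
    define v' where "v' = A v - \<mu> *s v"
    have Av: "A v = \<mu> *s v + v'" by (simp add: v'_def)
    have lm: "(q + inverse q) * \<mu> = l + m" "\<mu> * \<mu> = l * m - 1"
      using lam_shift_add[OF q0 x(1)] lam_shift_mult[OF q0 q2 x(1)]
      by (simp_all add: l_def m_def x(2) power2_eq_square)
    note sub = subspace_root_space[OF linear_A, of S]
    have "(q + inverse q) *s A (B v') - \<mu> *s B v' - B (A v') \<in> root_space A S"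
      using step.IH root_space_commute[OF _ linear_A, of "B v'" A S] unfolding v'_def[symmetric]
      by (intro subspace_diff[OF sub] subspace_scale[OF sub]) auto
    moreover have "A (A (B v) - m *s B v) - l *s (A (B v) - m *s B v)
        = (q + inverse q) *s A (B v') - \<mu> *s B v' - B (A v')"
    proof -
      have "A (A (B v)) = (q + inverse q) *s A (B (A v)) - B (A (A v)) - B v"
        using serre_AB[of v] by (simp add: algebra_simps eq_neg_iff_add_eq_0)
      also have "\<dots> = ((q + inverse q) * \<mu>) *s A (B v) + (q + inverse q) *s A (B v')
          - (\<mu> * \<mu>) *s B v - \<mu> *s B v' - B (A v') - B v"
        by (simp only: Av A.add A.scale B.add B.scale scale_right_distrib scale_scale)
          (simp add: Av B.add B.scale A.add A.scale scale_right_distrib)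
      finally show ?thesis
        unfolding lm by (simp add: A.diff A.scale algebra_simps)
    qed
    ultimately have "A (A (B v) - m *s B v) - l *s (A (B v) - m *s B v) \<in> root_space A S"
      by simp
    then have Bv: "B v \<in> root_space A S"
      using x(3,4) root_space.step unfolding l_def m_def by metis
    moreover have "B (A v) = \<mu> *s B v + B v'"
      by (simp add: Av B.add B.scale)
    ultimately show ?case
      using step.IH subspace_add[OF sub] subspace_scale[OF sub] by (simp add: v'_def)
  qed
  then show ?thesis ..
qed

section \<open>Modules over $U_q'({\rm so}_n)$\<close>

locale Uso_module = fin_dim scale
  for scale :: "complex \<Rightarrow> 'v::ab_group_add \<Rightarrow> 'v" (infixr \<open>*s\<close> 75) +
  fixes q s :: complex and n :: nat and T :: "nat free set \<Rightarrow> 'v \<Rightarrow> 'v"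
  assumes n: "n \<ge> 3" and q: "q \<noteq> 0" "\<forall>m::nat. m > 0 \<longrightarrow> q ^ m \<noteq> 1" and s: "s ^ 2 = q"
    and rep: "Uso_rep q n scale T" and irreducible: "Uso_irreducible q n scale T"
begin

abbreviation F :: "nat free ring" where "F \<equiv> free_algebra {2..n}"

text \<open>Pulling the representation back to the free algebra replaces computation with cosets by
  computation with noncommutative polynomials.\<close>

definition act :: "nat free \<Rightarrow> 'v \<Rightarrow> 'v" where
  "act p = T (Uso_class q n p)"

lemma act_ring_hom: "act \<in> ring_hom F (End_ring scale)"
proof -
  have "Uso_class q n \<in> ring_hom F (Uso q n)"
    unfolding Uso_class_def[abs_def] Uso_def
    by (rule ideal.rcos_ring_hom[OF ideal_so_ideal])
  from ring_hom_trans[OF this, of T "End_ring scale"] show ?thesis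
    using rep unfolding Uso_rep_def act_def[abs_def] comp_def by blast
qed

lemma act_mult: "p \<in> carrier F \<Longrightarrow> p' \<in> carrier F \<Longrightarrow> act (p * p') v = act p (act p' v)"
  using ring_hom_mult[OF act_ring_hom, of p p'] by (simp add: End_ring_def)

lemma act_add: "p \<in> carrier F \<Longrightarrow> p' \<in> carrier F \<Longrightarrow> act (p + p') v = act p v + act p' v"
  using ring_hom_add[OF act_ring_hom, of p p'] by (simp add: End_ring_def)

lemma act_const: "act (const c) v = c *s v"
  using rep unfolding Uso_rep_def act_def by simp

lemma act_diff:
  assumes "p \<in> carrier F" "p' \<in> carrier F"
  shows "act (p - p') v = act p v - act p' v"
  using act_add[OF diff_closed[OF assms] assms(2), of v] by (simp add: eq_diff_eq)

lemma act_uminus: "p \<in> carrier F \<Longrightarrow> act (- p) v = - act p v"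
  using act_diff[of 0 p v] act_const[of 0 v] by simp

lemma linear_act:
  assumes "p \<in> carrier F"
  shows "Vector_Spaces.linear scale scale (act p)"
  using ring_hom_closed[OF act_ring_hom assms] by (simp add: End_ring_def)

lemma act_ideal:
  assumes "p \<in> so_ideal q n"
  shows "act p v = 0"
proof -
  interpret ideal "so_ideal q n" F by (rule ideal_so_ideal)
  have "Uso_class q n p = so_ideal q n" "Uso_class q n 0 = so_ideal q n"
    unfolding Uso_class_def using a_rcos_const[OF assms] a_rcos_const[OF additive_subgroup.zero_closed[OF is_additive_subgroup]]
    by simp_all
  then have "act p = act 0" by (simp add: act_def)
  then show ?thesis using act_const[of 0 v] by simp
qed

lemma act_relator: "p \<in> so_relators q n \<Longrightarrow> act p v = 0"
  by (rule act_ideal) (simp add: so_ideal_def ring.genideal_self'[OF ring_free_algebra]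
    subsetD[OF ring.genideal_self[OF ring_free_algebra so_relators_subset]])

abbreviation G :: "nat \<Rightarrow> 'v \<Rightarrow> 'v" where "G j \<equiv> act (gen j)"

lemma serre_relations:
  assumes "2 \<le> i" "i + 1 \<le> n"
  shows "G i (G i (G (i + 1) v)) - (q + inverse q) *s G i (G (i + 1) (G i v)) + G (i + 1) (G i (G i v))
      = - G (i + 1) v" (is ?A)
    and "G (i + 1) (G (i + 1) (G i v)) - (q + inverse q) *s G (i + 1) (G i (G (i + 1) v))
      + G i (G (i + 1) (G (i + 1) v)) = - G i v" (is ?B)
proof -
  have ij: "i \<in> {2..n}" "i + 1 \<in> {2..n}" using assms by auto
  note closed = add_closed diff_closed uminus_closed mult_closed const_closed
    gen_closed[OF ij(1)] gen_closed[OF ij(2)]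
  have "act (gen i ^ 2 * gen (i + 1) - const (q + inverse q) * gen i * gen (i + 1) * gen i
        + gen (i + 1) * gen i ^ 2 - (- gen (i + 1))) v = 0"
    by (rule act_relator) (use assms in \<open>auto simp only: so_relators_def\<close>)
  then show ?A
    by (simp only: power2_eq_square act_add act_diff act_uminus act_mult act_const closed
        eq_iff_diff_eq_0[symmetric] mult.assoc)
  have "act (gen i * gen (i + 1) ^ 2 - const (q + inverse q) * gen (i + 1) * gen i * gen (i + 1)
        + gen (i + 1) ^ 2 * gen i - (- gen i)) v = 0"
    by (rule act_relator) (use assms in \<open>auto simp only: so_relators_def\<close>)
  then have "G i (G (i + 1) (G (i + 1) v)) - (q + inverse q) *s G (i + 1) (G i (G (i + 1) v))
      + G (i + 1) (G (i + 1) (G i v)) = - G i v"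
    by (simp only: power2_eq_square act_add act_diff act_uminus act_mult act_const closed
        eq_iff_diff_eq_0[symmetric] mult.assoc)
  moreover have "x - y + z = z - y + x" for x y z :: 'v by simp
  ultimately show ?B by (rule trans[rotated])
qed

lemma gen_commute:
  assumes "i \<in> {2..n}" "j \<in> {2..n}" "\<bar>int i - int j\<bar> > 1"
  shows "G i (G j v) = G j (G i v)"
proof -
  have "act (gen i * gen j - gen j * gen i) v = 0"
    by (rule act_relator) (use assms in \<open>auto simp only: so_relators_def\<close>)
  then show ?thesis
    by (simp only: act_diff act_mult mult_closed gen_closed assms eq_iff_diff_eq_0[symmetric])
qed

lemma serre_pair_gen:
  assumes "i \<in> {2..n}" "j \<in> {2..n}" "j = i + 1 \<or> i = j + 1"
  shows "serre_pair scale q (G i) (G j)"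
proof -
  have lin: "Vector_Spaces.linear scale scale (G i)" "Vector_Spaces.linear scale scale (G j)"
    by (rule linear_act[OF gen_closed[OF assms(1)]], rule linear_act[OF gen_closed[OF assms(2)]])
  show ?thesis
  proof (intro serre_pair.intro serre_pair_axioms.intro fin_dim_axioms q lin)
    fix v
    show "G i (G i (G j v)) - (q + inverse q) *s G i (G j (G i v)) + G j (G i (G i v)) = - G j v"
      using assms serre_relations[of i] serre_relations[of j] by auto
    show "G j (G j (G i v)) - (q + inverse q) *s G j (G i (G j v)) + G i (G j (G j v)) = - G i v"
      using assms serre_relations[of i] serre_relations[of j] by auto
  qed
qed

text \<open>Stability passes from generators to words by induction on their length, then to all
  elements by adding one term at a time.\<close>

lemma act_invariant:
  assumes W: "subspace W" and inv: "\<And>j v. j \<in> {2..n} \<Longrightarrow> v \<in> W \<Longrightarrow> G j v \<in> W"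
    and p: "p \<in> carrier F" and v: "v \<in> W"
  shows "act p v \<in> W"
proof -
  have monomial: "act (Poly_Mapping.single (Word ws) c) v \<in> W" if "set ws \<subseteq> {2..n}" for ws c
    using that
  proof (induction ws arbitrary: c)
    case Nil
    show ?case using act_const[of c v] subspace_scale[OF W v] by (simp add: zero_word_def)
  next
    case (Cons j ws)
    have "Poly_Mapping.single (Word (j # ws)) c = gen j * Poly_Mapping.single (Word ws) c"
      by (simp add: mult_single plus_word_def)
    moreover have "Poly_Mapping.single (Word ws) c \<in> carrier F" "gen j \<in> carrier F"
      using Cons.prems by (auto simp: gen_closed)
    ultimately show ?case using Cons inv act_mult by auto
  qed
  show ?thesis using p
  proof (induction p rule: update_induct)
    case const
    show ?case using act_const[of 0 v] subspace_0[OF W] by simp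
  next
    case (update p w c)
    have upd: "Poly_Mapping.update w c p = p + Poly_Mapping.single w c"
      using update.hyps
      by (intro poly_mapping_eqI) (auto simp: lookup_update lookup_add lookup_single in_keys_iff when_def split: if_splits)
    have keys: "Poly_Mapping.keys (Poly_Mapping.update w c p) = insert w (Poly_Mapping.keys p)"
      using update.hyps by (auto simp: in_keys_iff lookup_update split: if_splits)
    have p: "p \<in> carrier F" and w: "set (letters w) \<subseteq> {2..n}"
      using update.prems unfolding free_algebra_simps(1) keys by auto
    have "Poly_Mapping.single w c \<in> carrier F" using w by simp
    then show ?case
      unfolding upd using act_add[OF p] update.IH[OF p] monomial[of "letters w" c] w subspace_add[OF W]
      by simp
  qed
qed

lemma invariant_trivial:
  assumes W: "subspace W" and inv: "\<And>j v. j \<in> {2..n} \<Longrightarrow> v \<in> W \<Longrightarrow> G j v \<in> W"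
  shows "W = {0} \<or> W = UNIV"
proof -
  have "T x ` W \<subseteq> W" if "x \<in> carrier (Uso q n)" for x
  proof -
    obtain p where "p \<in> carrier F" "x = Uso_class q n p"
      using \<open>x \<in> carrier (Uso q n)\<close> unfolding Uso_def FactRing_def A_RCOSETS_def' Uso_class_def
      by auto
    then show ?thesis using act_invariant[OF assms] by (auto simp: act_def)
  qed
  then show ?thesis using W irreducible unfolding Uso_irreducible_def by blast
qed

text \<open>The root space of \<open>G i\<close> for the classical values is a submodule: neighbours
  preserve it by \<open>root_space_invariant\<close>, all other generators because they commute with
  \<open>G i\<close>. Irreducibility makes it 0 or everything.\<close>

lemma all_or_none_classical:
  assumes i: "i \<in> {2..n}"
  shows "(\<forall>\<mu>. eigenvalue_of scale (G i) \<mu> \<longrightarrow> classical_type q s \<mu>) \<or>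
    (\<forall>\<mu>. eigenvalue_of scale (G i) \<mu> \<longrightarrow> \<not> classical_type q s \<mu>)"
proof -
  define S where "S = {\<mu>. classical_type q s \<mu>}"
  define W where "W = root_space (G i) S"
  have lin: "Vector_Spaces.linear scale scale (G j)" if "j \<in> {2..n}" for j
    by (rule linear_act[OF gen_closed[OF that]])
  \<comment> \<open>Moving to a neighbour changes the exponent of x^2 by 2, so classical values are
    closed under both shifts.\<close>
  have S: "\<exists>x. x \<noteq> 0 \<and> \<mu> = lam q x \<and> lam q (q * x) \<in> S \<and> lam q (x / q) \<in> S" if "\<mu> \<in> S" for \<mu>
  proof -
    obtain x and l :: int where x: "x \<noteq> 0" "x ^ 2 = q powi l" "\<mu> = lam q x"
      using \<open>\<mu> \<in> S\<close> classical_type_iff[OF s q(1)] unfolding S_def by blast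
    have "(q * x) ^ 2 = q powi (l + 2)" "(x / q) ^ 2 = q powi (l - 2)"
      using x(2) q(1) by (simp_all add: power_int_add power_int_diff power_mult_distrib power_divide)
    moreover have "q * x \<noteq> 0" "x / q \<noteq> 0" using x q by auto
    ultimately show ?thesis
      using x classical_type_iff[OF s q(1)] unfolding S_def by blast
  qed
  have "G j v \<in> W" if j: "j \<in> {2..n}" and v: "v \<in> W" for j v
  proof -
    consider "j = i" | "j = i + 1 \<or> i = j + 1" | "\<bar>int i - int j\<bar> > 1" by linarith
    then show ?thesis
    proof cases
      case 2
      then interpret serre_pair scale q "G i" "G j" using serre_pair_gen i j by blast
      show ?thesis using root_space_invariant[OF S] v unfolding W_def by blast
    next
      case 3
      then show ?thesis
        using root_space_commute[OF v[unfolded W_def] lin[OF j]] gen_commute[OF i j] unfolding W_def by blast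
    qed (use root_space_commute[OF v[unfolded W_def] lin[OF j]] W_def in auto)
  qed
  then consider "W = {0}" | "W = UNIV"
    using invariant_trivial subspace_root_space[OF lin[OF i]] unfolding W_def by blast
  then show ?thesis
  proof cases
    case 1
    then show ?thesis
      using eigenvector_in_root_space[of "G i" _ _ S] unfolding W_def eigenvalue_of_def S_def by blast
  next
    case 2
    then show ?thesis
      using root_space_eigenvalue[OF _ lin[OF i], of _ S] unfolding W_def eigenvalue_of_def S_def by blast
  qed
qed

section \<open>Propagation of the type along the chain of generators\<close>

definition all_classical :: "nat \<Rightarrow> bool" where
  "all_classical i \<longleftrightarrow> (\<forall>\<mu>. eigenvalue_of scale (G i) \<mu> \<longrightarrow> classical_type q s \<mu>)"

text \<open>One eigenvalue of \<open>G i\<close> exists and transfers to a single classical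
  eigenvalue of \<open>G j\<close>; the dichotomy upgrades one to all.\<close>

lemma all_classical_neighbour:
  assumes i: "i \<in> {2..n}" "j \<in> {2..n}" "j = i + 1 \<or> i = j + 1" and "all_classical i"
  shows "all_classical j"
proof -
  interpret serre_pair scale q "G i" "G j" by (rule serre_pair_gen[OF i])
  have "(UNIV :: 'v set) \<noteq> {0}" using irreducible unfolding Uso_irreducible_def by blast
  then obtain \<mu> where \<mu>: "eigenvalue_of scale (G i) \<mu>" using ex_eigenvalue[OF linear_A] by blast
  then have "classical_type q s \<mu>" using assms(4) unfolding all_classical_def by blast
  then obtain \<nu> where "eigenvalue_of scale (G j) \<nu>" "classical_type q s \<nu>"
    using classical_eigenvalue_transfer[OF s \<mu>] by blast
  then show ?thesis using all_or_none_classical[OF i(2)] unfolding all_classical_def by blast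
qed

lemma all_classical_iff:
  assumes "i \<in> {2..n}"
  shows "all_classical i \<longleftrightarrow> all_classical 2"
proof -
  have "i \<le> n \<longrightarrow> all_classical i = all_classical 2" if "2 \<le> i"
    using that
  proof (induction i rule: dec_induct)
    case (step i)
    show ?case
    proof
      assume "Suc i \<le> n"
      then have i: "i \<in> {2..n}" "Suc i \<in> {2..n}" using step.hyps by auto
      have "all_classical (Suc i) = all_classical i"
        using all_classical_neighbour[OF i] all_classical_neighbour[OF i(2,1)] by auto
      then show "all_classical (Suc i) = all_classical 2" using step.IH i by simp
    qed
  qed simp
  then show ?thesis using assms by simp
qed

lemma eigenvalue_types:
  "(\<forall>i\<in>{2..n}. \<forall>\<mu>. eigenvalue_of scale (G i) \<mu> \<longrightarrow> classical_type q s \<mu>) \<or>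
   (\<forall>i\<in>{2..n}. \<forall>\<mu>. eigenvalue_of scale (G i) \<mu> \<longrightarrow> nonclassical_type q s \<mu>)"
proof (cases "all_classical 2")
  case True
  then show ?thesis using all_classical_iff unfolding all_classical_def by blast
next
  case False
  have "nonclassical_type q s \<mu>" if i: "i \<in> {2..n}" and ev: "eigenvalue_of scale (G i) \<mu>" for i \<mu>
  proof -
    \<comment> \<open>The restriction to nonclassical values comes from a pair, so each generator
      needs a neighbour; for i = 2 this is where n \<ge> 3 enters.\<close>
    obtain j where "j \<in> {2..n}" "j = i + 1 \<or> i = j + 1"
    proof (cases "i = 2")
      case True
      then show ?thesis using that[of 3] n by simp
    next
      case False
      then have "i - 1 \<in> {2..n}" "i = (i - 1) + 1" using i by auto
      then show ?thesis using that by blast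
    qed
    then interpret serre_pair scale q "G i" "G j" using serre_pair_gen i by blast
    have "\<not> all_classical i" using False all_classical_iff[OF i] by simp
    then have "\<not> classical_type q s \<mu>"
      using all_or_none_classical[OF i] ev unfolding all_classical_def by blast
    then show ?thesis using nonclassical_if_not_classical[OF s ev] by blast
  qed
  then show ?thesis by blast
qed

end


theorem proposition2:
  fixes q s :: complex and n k :: nat
    and scale :: "complex \<Rightarrow> 'v::ab_group_add \<Rightarrow> 'v"
    and T :: "nat free set \<Rightarrow> 'v \<Rightarrow> 'v"
  assumes "n \<ge> 3" and "k = n div 2"
    and "q \<noteq> 0" and "\<forall>m::nat. m > 0 \<longrightarrow> q ^ m \<noteq> 1"
    and "s ^ 2 = q"
    and "Uso_rep q n scale T"
    and "finite_dimensional scale"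
    and "Uso_irreducible q n scale T"
  shows "(\<forall>i\<in>{1..k}.
            (\<forall>\<mu>. eigenvalue_of scale (T (Uso_gen q n (2 * i))) \<mu> \<longrightarrow> classical_type q s \<mu>) \<or>
            (\<forall>\<mu>. eigenvalue_of scale (T (Uso_gen q n (2 * i))) \<mu> \<longrightarrow> nonclassical_type q s \<mu>)) \<and>
         ((\<forall>i\<in>{1..k}. \<forall>\<mu>.
            eigenvalue_of scale (T (Uso_gen q n (2 * i))) \<mu> \<longrightarrow> classical_type q s \<mu>) \<or>
          (\<forall>i\<in>{1..k}. \<forall>\<mu>.
            eigenvalue_of scale (T (Uso_gen q n (2 * i))) \<mu> \<longrightarrow> nonclassical_type q s \<mu>))"
proof -
  interpret vector_space scale
    using \<open>Uso_rep q n scale T\<close> unfolding Uso_rep_def by blast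
  interpret Uso_module scale q s n T
    using assms by unfold_locales auto
  have "2 * i \<in> {2..n}" if "i \<in> {1..k}" for i
    using that \<open>k = n div 2\<close> by auto
  then show ?thesis
    using eigenvalue_types unfolding act_def by blast
qed

end
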